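(* Let $s,t\ge1$ be coprime integers. Then the $t$-core $\lambda^t$ of an $s$-core $\lambda$ is uniquely determined by the multiset of residues modulo $t$ of the elements of $\mathcal{S}_s(\lambda)$. Moreover, two $s$-cores $\lambda,\mu$ satisfy $\lambda^t=\mu^t$ if and only if the multisets of residues modulo $t$ of $\mathcal{S}_s(\lambda)$ and of $\mathcal{S}_s(\mu)$ are equal.
   Context: A partition is an infinite weakly decreasing sequence $\lambda=(\lambda_1,\lambda_2,\ldots)$ of nonnegative integers with finite sum. Its Young diagram is $[\lambda]=\{(r,c)\in\mathbb{Z}_{>0}^2 : c\le\lambda_r\}$, its conjugate $\overline{\lambda}$ is given by $\overline{\lambda}_r=\#\{c\in\mathbb{Z}_{>0}: r\le\lambda_c\}$. The rim hook of $(r,c)\in[\lambda]$ is $\{(i,j)\in[\lambda]: i\ge r,\ j\ge c,\ (i+1,j+1)\notin[\lambda]\}$, of length $1+(\lambda_r-r)+(\overline{\lambda}_c-c)$; removing it leaves the Young diagram of a smaller partition. A partition is an $s$-core if it has no rim hook of length $s$. For any partition $\lambda$ and $t\ge1$, repeatedly removing rim hooks of length $t$ until none remains yields a $t$-core, independent of the choices made, denoted $\lambda^t$ and called the $t$-core of $\lambda$. The beta-set of $\lambda$ is $B^\lambda=\{\lambda_i-i: i\ge1\}\subset\mathbb{Z}$. For an $s$-core $\lambda$, the $s$-set of $\lambda$ is $\mathcal{S}_s(\lambda)=(B^\lambda+s)\setminus B^\lambda$, a set of $s$ integers, one in each residue class modulo $s$. *)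

theory Defs
  imports Complex_Main "HOL-Library.Multiset"
begin

text \<open>
  Sequences are indexed from 1. The unused entry at index 0 is fixed to be 0, so that two partitions
  are equal as functions iff all their parts agree.
  The type \<^typ>\<open>nat\<close> carries the discrete topology, so \<^const>\<open>summable\<close> says exactly that the
  sum of the parts is finite.
\<close>

definition is_partition :: "(nat \<Rightarrow> nat) \<Rightarrow> bool" where
  "is_partition lam \<longleftrightarrow>
     lam 0 = 0 \<and> (\<forall>i\<ge>1. lam (i + 1) \<le> lam i) \<and> summable lam"

lemma is_partition_iff_finite_support:
  "is_partition lam \<longleftrightarrow>
     lam 0 = 0 \<and> (\<forall>i\<ge>1. lam (i + 1) \<le> lam i) \<and> finite {i. lam i \<noteq> 0}"
proof -
  have "finite {i. lam i \<noteq> 0}" if "summable lam"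
  proof -
    obtain s where "(\<lambda>n. sum lam {..<n}) \<longlonglongrightarrow> s"
      using \<open>summable lam\<close> by (auto simp: summable_def sums_def)
    then have "eventually (\<lambda>n. sum lam {..<n} = s) sequentially"
      by (simp add: tendsto_discrete)
    then obtain N where N: "\<And>n. n \<ge> N \<Longrightarrow> sum lam {..<n} = s"
      by (auto simp: eventually_sequentially)
    have "lam n = 0" if "n \<ge> N" for n
      using N[of n] N[of "Suc n"] that by simp
    then have "{i. lam i \<noteq> 0} \<subseteq> {..<N}"
      by (metis (mono_tags, lifting) lessThan_iff mem_Collect_eq not_le subsetI)
    then show ?thesis
      by (rule finite_subset) simp
  qed
  moreover have "summable lam" if "finite {i. lam i \<noteq> 0}"
    using that by (rule summable_finite) simp
  ultimately show ?thesis
    by (auto simp: is_partition_def)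
qed

definition diagram :: "(nat \<Rightarrow> nat) \<Rightarrow> (nat \<times> nat) set" where
  "diagram lam = {(r, c). 1 \<le> r \<and> 1 \<le> c \<and> c \<le> lam r}"

definition conjugate :: "(nat \<Rightarrow> nat) \<Rightarrow> nat \<Rightarrow> nat" where
  "conjugate lam r = (if r = 0 then 0 else card {c. 1 \<le> c \<and> r \<le> lam c})"

definition rim_hook :: "(nat \<Rightarrow> nat) \<Rightarrow> nat \<Rightarrow> nat \<Rightarrow> (nat \<times> nat) set" where
  "rim_hook lam r c =
     {(i, j). (i, j) \<in> diagram lam \<and> r \<le> i \<and> c \<le> j \<and> (i + 1, j + 1) \<notin> diagram lam}"

definition hook_length :: "(nat \<Rightarrow> nat) \<Rightarrow> nat \<Rightarrow> nat \<Rightarrow> int" where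
  "hook_length lam r c = 1 + (int (lam r) - int r) + (int (conjugate lam c) - int c)"

definition is_core :: "nat \<Rightarrow> (nat \<Rightarrow> nat) \<Rightarrow> bool" where
  "is_core s lam \<longleftrightarrow>
     is_partition lam \<and> (\<forall>(r, c)\<in>diagram lam. hook_length lam r c \<noteq> int s)"

definition removes_rim_hook :: "nat \<Rightarrow> (nat \<Rightarrow> nat) \<Rightarrow> (nat \<Rightarrow> nat) \<Rightarrow> bool" where
  "removes_rim_hook t lam mu \<longleftrightarrow>
     is_partition lam \<and> is_partition mu \<and>
     (\<exists>(r, c)\<in>diagram lam. hook_length lam r c = int t \<and>
        diagram mu = diagram lam - rim_hook lam r c)"

definition core_of :: "nat \<Rightarrow> (nat \<Rightarrow> nat) \<Rightarrow> (nat \<Rightarrow> nat)" where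
  "core_of t lam = (THE mu. (removes_rim_hook t)\<^sup>*\<^sup>* lam mu \<and> is_core t mu)"

definition beta_set :: "(nat \<Rightarrow> nat) \<Rightarrow> int set" where
  "beta_set lam = {int (lam i) - int i | i. 1 \<le> i}"

definition s_set :: "nat \<Rightarrow> (nat \<Rightarrow> nat) \<Rightarrow> int set" where
  "s_set s lam = (\<lambda>b. b + int s) ` beta_set lam - beta_set lam"

text \<open>
  \<^const>\<open>mset_set\<close> is empty on infinite sets, but \<^term>\<open>s_set s lam\<close> is finite for every
  partition: it is bounded above, and all sufficiently small integers lie in
  \<^term>\<open>beta_set lam\<close>.
\<close>

definition s_set_residues :: "nat \<Rightarrow> nat \<Rightarrow> (nat \<Rightarrow> nat) \<Rightarrow> int multiset" where
  "s_set_residues s t lam = image_mset (\<lambda>x. x mod int t) (mset_set (s_set s lam))"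

end

theory Submission
  imports Defs "HOL-Number_Theory.Cong"
begin

text \<open>
  Two sets of integers with finite symmetric difference can be compared by the signed number of
  elements in which they differ, separately in each residue class modulo \<open>t\<close>. Removing a rim hook
  of length \<open>t\<close> moves one element \<open>b\<close> of the beta-set to \<open>b - t\<close>, so it does not change these
  numbers; the beta-set of a \<open>t\<close>-core is closed under subtracting \<open>t\<close>, so it is determined by them.
  Hence two partitions have equal \<open>t\<close>-cores iff the differences \<open>d a\<close> between their beta-sets vanish
  in all classes \<open>a\<close>. For \<open>s\<close>-cores the \<open>s\<close>-set is the excess of \<open>B + s\<close> over \<open>B\<close>, so the
  multisets of residues agree iff \<open>d (a - s) = d a\<close> for all \<open>a\<close>; by coprimality this means that
  \<open>d\<close> is constant, and the constant is \<open>0\<close> because the total difference of two beta-sets is \<open>0\<close>.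
\<close>

section \<open>Signed differences of sets\<close>

text \<open>Elements of \<open>A - B\<close> count 1 and elements of \<open>B - A\<close> count -1.
  Summing over the symmetric difference makes sense for infinite sets that differ in finitely many
  places; over an infinite index set the sum would default to 0.\<close>

definition balance :: "'a set \<Rightarrow> 'a set \<Rightarrow> 'a set \<Rightarrow> int" where
  "balance P A B = (\<Sum>x\<in>P \<inter> sym_diff A B. of_bool (x \<in> A) - of_bool (x \<in> B))"

text \<open>The summand vanishes off the symmetric difference, so several balances can be written
  over one common finite set.\<close>

lemma balance_eq_sum:
  assumes "finite U" "sym_diff A B \<subseteq> U"
  shows "balance P A B = (\<Sum>x\<in>P \<inter> U. of_bool (x \<in> A) - of_bool (x \<in> B))"
  unfolding balance_def by (rule sum.mono_neutral_left) (use assms in auto)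

lemma balance_trans:
  assumes "finite (sym_diff A B)" "finite (sym_diff B C)"
  shows "balance P A C = balance P A B + balance P B C"
proof -
  let ?U = "sym_diff A B \<union> sym_diff B C"
  have U: "finite ?U" using assms by simp
  show ?thesis
    by (subst (1 2 3) balance_eq_sum[OF U]) (auto simp flip: sum.distrib)
qed

lemma balance_swap: "balance P B A = - balance P A B"
proof -
  have "sym_diff B A = sym_diff A B" by blast
  then show ?thesis by (simp add: balance_def flip: sum_negf)
qed

lemma balance_self [simp]: "balance P A A = 0"
  by (simp add: balance_def)

lemma balance_superset:
  assumes "B \<subseteq> A"
  shows "balance P A B = int (card (P \<inter> (A - B)))"
proof -
  have *: "P \<inter> sym_diff A B = P \<inter> (A - B)" using assms by auto
  have "balance P A B = (\<Sum>x\<in>P \<inter> (A - B). 1)"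
    unfolding balance_def * by (rule sum.cong) auto
  then show ?thesis by simp
qed

lemma balance_image:
  assumes "inj f"
  shows "balance P (f ` A) (f ` B) = balance (f -` P) A B"
proof -
  have "P \<inter> sym_diff (f ` A) (f ` B) = f ` (f -` P \<inter> sym_diff A B)"
    using assms by (auto simp: inj_image_mem_iff image_set_diff[symmetric])
  then show ?thesis
    using assms unfolding balance_def
    by (simp add: sum.reindex inj_on_subset inj_image_mem_iff)
qed

lemma balance_UNIV_partition:
  assumes "finite (sym_diff A B)" "finite I" "\<And>x. g x \<in> I"
  shows "balance UNIV A B = (\<Sum>i\<in>I. balance {x. g x = i} A B)"
proof -
  have "(\<Sum>i\<in>I. balance {x. g x = i} A B) =
    (\<Sum>i\<in>I. \<Sum>x\<in>{x \<in> sym_diff A B. g x = i}. of_bool (x \<in> A) - of_bool (x \<in> B))"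
    unfolding balance_def by (intro sum.cong refl) auto
  also have "\<dots> = balance UNIV A B"
    unfolding balance_def using assms by (subst sum.group) auto
  finally show ?thesis by simp
qed

text \<open>When the traces on \<open>P\<close> are nested, all summands have the same sign, so a
  zero sum leaves no element in which they differ.\<close>

lemma balance_eq_0_chain:
  assumes "finite (sym_diff A B)" "balance P A B = 0" and chain: "P \<inter> A \<subseteq> B \<or> P \<inter> B \<subseteq> A"
  shows "P \<inter> A = P \<inter> B"
proof -
  have *: "P \<inter> C = P \<inter> D"
    if "finite (sym_diff C D)" "balance P C D = 0" "P \<inter> D \<subseteq> C" for C D
  proof -
    have eq: "P \<inter> sym_diff C D = P \<inter> (C - D)" using that(3) by auto
    have "balance P C D = (\<Sum>x\<in>P \<inter> (C - D). 1)"
      unfolding balance_def eq by (rule sum.cong) auto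
    then have "P \<inter> (C - D) = {}" using that(1,2) by simp
    with that(3) show ?thesis by auto
  qed
  show ?thesis
    using chain
  proof
    assume "P \<inter> A \<subseteq> B"
    moreover have "finite (sym_diff B A)" using assms(1) by (subst Un_commute)
    moreover have "balance P B A = 0" using assms(2) by (subst balance_swap) simp
    ultimately show ?thesis by (intro *[symmetric])
  next
    assume "P \<inter> B \<subseteq> A"
    then show ?thesis using assms(1,2) by (intro *)
  qed
qed

section \<open>Beta-sets of partitions\<close>

lemma partition_antimono:
  assumes "is_partition lam" "1 \<le> i" "i \<le> j"
  shows "lam j \<le> lam i"
  using assms(3)
proof (induction j rule: dec_induct)
  case (step n)
  then have "lam (n + 1) \<le> lam n" using assms(1,2) by (simp add: is_partition_def)
  then show ?case using step.IH by simp
qed simp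

lemma partition_vanishes:
  assumes "is_partition lam"
  shows "\<exists>N. \<forall>i>N. lam i = 0"
proof -
  have "finite {i. lam i \<noteq> 0}" using assms by (simp add: is_partition_iff_finite_support)
  then obtain N where "\<forall>i\<in>{i. lam i \<noteq> 0}. i \<le> N" by (auto simp: finite_nat_set_iff_bounded_le)
  then have "\<forall>i>N. lam i = 0" by force
  then show ?thesis ..
qed

abbreviation beta :: "(nat \<Rightarrow> nat) \<Rightarrow> nat \<Rightarrow> int" where
  "beta lam i \<equiv> int (lam i) - int i"

lemma beta_set_eq_image: "beta_set lam = beta lam ` {1..}"
  by (auto simp: beta_set_def)

lemma beta_less_iff:
  assumes "is_partition lam" "1 \<le> i" "1 \<le> j"
  shows "beta lam i < beta lam j \<longleftrightarrow> j < i"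
  using partition_antimono[OF assms(1,2), of j] partition_antimono[OF assms(1,3), of i]
  by (cases i j rule: linorder_cases) auto

lemma inj_on_beta:
  assumes "is_partition lam"
  shows "inj_on (beta lam) {1..}"
proof (rule linorder_inj_onI)
  fix i j :: nat assume "i < j" "i \<in> {1..}" "j \<in> {1..}"
  then show "beta lam i \<noteq> beta lam j" using beta_less_iff[OF assms, of j i] by simp
qed auto

text \<open>From index 1 on, \<open>beta\<close> is strictly decreasing, so its n-th entry is the
  n-th largest element of the set.\<close>

lemma beta_set_inject:
  assumes "is_partition lam" "is_partition mu" "beta_set lam = beta_set mu"
  shows "lam = mu"
proof -
  \<comment> \<open>By symmetry one inequality suffices. A larger \<open>beta nu n\<close> would
    occur in the sequence of \<open>ka\<close> at some \<open>k < n\<close>, where the two sequences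
    already agree, and hence twice in that of \<open>nu\<close>.\<close>
  have le: "beta nu n \<le> beta ka n"
    if part: "is_partition nu" "is_partition ka" and eq: "beta_set nu = beta_set ka"
      and n: "1 \<le> n" and IH: "\<And>k. k < n \<Longrightarrow> 1 \<le> k \<Longrightarrow> beta nu k = beta ka k" for n nu ka
  proof (rule ccontr)
    assume "\<not> ?thesis"
    then have less: "beta ka n < beta nu n" by simp
    obtain k where k: "1 \<le> k" "beta nu n = beta ka k"
      using eq n unfolding beta_set_eq_image by blast
    with less have "k < n" using beta_less_iff[OF part(2) n k(1)] by simp
    then show False using IH[OF _ k(1)] k beta_less_iff[OF part(1) n k(1)] by simp
  qed
  have "beta lam n = beta mu n" if "1 \<le> n" for n
    using that
  proof (induction n rule: less_induct)
    case (less n)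
    show ?case
      using le[OF assms(1,2,3) less.prems] le[OF assms(2,1) assms(3)[symmetric] less.prems] less.IH
      by (metis order_antisym)
  qed
  moreover have "lam 0 = mu 0" using assms by (simp add: is_partition_def)
  ultimately have "lam n = mu n" for n by (cases "n = 0") force+
  then show ?thesis by blast
qed

text \<open>An index \<open>i > N\<close> contributes \<open>- i\<close>, so the tail fills
  everything below \<open>- N\<close>.\<close>

lemma beta_set_eq:
  assumes "\<And>i. i > N \<Longrightarrow> lam i = 0"
  shows "beta_set lam = beta lam ` {1..N} \<union> {..< - int N}"
proof -
  have "{1..} = {1..N} \<union> {N<..}" by auto
  moreover have "beta lam ` {N<..} = {..< - int N}"
  proof
    show "beta lam ` {N<..} \<subseteq> {..< - int N}" using assms by auto
    show "{..< - int N} \<subseteq> beta lam ` {N<..}"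
    proof
      fix x assume "x \<in> {..< - int N}"
      then have "nat (- x) > N" "x = beta lam (nat (- x))" using assms[of "nat (- x)"] by auto
      then show "x \<in> beta lam ` {N<..}" by blast
    qed
  qed
  ultimately show ?thesis by (simp add: beta_set_eq_image image_Un)
qed

lemma
  assumes "is_partition lam" "is_partition mu"
  shows finite_sym_diff_beta_sets: "finite (sym_diff (beta_set lam) (beta_set mu))"
    and balance_UNIV_beta_sets: "balance UNIV (beta_set lam) (beta_set mu) = 0"
proof -
  obtain N1 where N1: "\<And>i. i > N1 \<Longrightarrow> lam i = 0" using partition_vanishes[OF assms(1)] by blast
  obtain N2 where N2: "\<And>i. i > N2 \<Longrightarrow> mu i = 0" using partition_vanishes[OF assms(2)] by blast
  \<comment> \<open>Beyond a cut-off common to both partitions the tails coincide, and each beta-set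
    has exactly \<open>N\<close> elements above them.\<close>
  define N where "N = max N1 N2"
  define U where "U = beta lam ` {1..N} \<union> beta mu ` {1..N}"
  have lam: "beta_set lam = beta lam ` {1..N} \<union> {..< - int N}"
    by (rule beta_set_eq) (simp add: N_def N1)
  have mu: "beta_set mu = beta mu ` {1..N} \<union> {..< - int N}"
    by (rule beta_set_eq) (simp add: N_def N2)
  have sub: "sym_diff (beta_set lam) (beta_set mu) \<subseteq> U"
    unfolding lam mu U_def by blast
  have U: "finite U" by (simp add: U_def)
  show "finite (sym_diff (beta_set lam) (beta_set mu))" using sub U by (rule finite_subset)
  have ge: "U \<inter> {..< - int N} = {}" by (auto simp: U_def)
  have "beta_set lam \<inter> U = beta lam ` {1..N}" "beta_set mu \<inter> U = beta mu ` {1..N}"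
    using ge unfolding lam mu by (auto simp: U_def)
  moreover have "card (beta nu ` {1..N}) = N" if "is_partition nu" for nu
    using inj_on_subset[OF inj_on_beta[OF that]] by (subst card_image) auto
  ultimately have card: "card (beta_set lam \<inter> U) = N" "card (beta_set mu \<inter> U) = N"
    using assms by simp_all
  have "balance UNIV (beta_set lam) (beta_set mu) =
      (\<Sum>x\<in>U. of_bool (x \<in> beta_set lam)) - (\<Sum>x\<in>U. of_bool (x \<in> beta_set mu))"
    by (simp add: balance_eq_sum[OF U sub] sum_subtractf)
  also have "\<dots> = 0"
    using U card by (simp add: Int_commute)
  finally show "balance UNIV (beta_set lam) (beta_set mu) = 0" .
qed

lemma finite_sym_diff_beta_set_shift:
  assumes "is_partition lam"
  shows "finite (sym_diff ((\<lambda>b. b + int s) ` beta_set lam) (beta_set lam))"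
proof -
  obtain N where "\<And>i. i > N \<Longrightarrow> lam i = 0" using partition_vanishes[OF assms] by blast
  then have eq: "beta_set lam = beta lam ` {1..N} \<union> {..< - int N}" by (rule beta_set_eq)
  have "sym_diff ((\<lambda>b. b + int s) ` beta_set lam) (beta_set lam) \<subseteq>
      beta lam ` {1..N} \<union> (\<lambda>b. b + int s) ` beta lam ` {1..N} \<union> {- int N..<int s - int N}"
    (is "sym_diff ?A ?B \<subseteq> ?U")
  proof
    fix x assume x: "x \<in> sym_diff ?A ?B"
    \<comment> \<open>Outside \<open>?U\<close> only the two tails matter, and they differ just in
      the window from \<open>- N\<close> to \<open>s - N\<close>, which is part of
      \<open>?U\<close>.\<close>
    have "x \<in> ?B \<longleftrightarrow> x < - int N" "x \<in> ?A \<longleftrightarrow> x < int s - int N" if "x \<notin> ?U"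
    proof -
      show "x \<in> ?B \<longleftrightarrow> x < - int N" using that unfolding eq by blast
      have "x \<in> ?A \<longleftrightarrow> x \<in> (\<lambda>b. b + int s) ` {..< - int N}" using that unfolding eq by blast
      also have "\<dots> \<longleftrightarrow> x < int s - int N" by (auto simp: image_iff intro!: bexI[of _ "x - int s"])
      finally show "x \<in> ?A \<longleftrightarrow> x < int s - int N" .
    qed
    with x show "x \<in> ?U" by (cases "x \<in> ?U") auto
  qed
  then show ?thesis by (rule finite_subset) auto
qed

section \<open>Rim hooks in terms of beta-sets\<close>

text \<open>The parts decrease weakly, so a column is an initial segment of the row indices and its
  cardinality is its last row.\<close>

lemma column_eq:
  assumes "is_partition lam" "1 \<le> c"
  shows "{k. 1 \<le> k \<and> c \<le> lam k} = {1..conjugate lam c}"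
proof -
  let ?A = "{k. 1 \<le> k \<and> c \<le> lam k}"
  have "finite ?A"
    by (rule finite_subset[of _ "{i. lam i \<noteq> 0}"])
      (use assms in \<open>auto simp: is_partition_iff_finite_support\<close>)
  show ?thesis
  proof (cases "?A = {}")
    case True
    moreover from this have "conjugate lam c = 0"
      using assms(2) unfolding conjugate_def by (simp only: card.empty) simp
    ultimately show ?thesis by simp
  next
    case False
    then have "Max ?A \<in> ?A" using \<open>finite ?A\<close> by (rule Max_in[rotated])
    then have "?A = {1..Max ?A}"
      using \<open>finite ?A\<close> partition_antimono[OF assms(1)] by (auto intro: order_trans)
    moreover from this have "conjugate lam c = Max ?A"
      using assms(2) card_atLeastAtMost[of 1 "Max ?A"] by (simp add: conjugate_def)
    ultimately show ?thesis by simp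
  qed
qed

lemma conjugate_eqI:
  assumes "is_partition lam" "1 \<le> c" "1 \<le> r" "c \<le> lam r" "lam (r + 1) < c"
  shows "conjugate lam c = r"
proof -
  have "r \<in> {1..conjugate lam c}" "r + 1 \<notin> {1..conjugate lam c}"
    using assms unfolding column_eq[OF assms(1,2), symmetric] by auto
  then show ?thesis by auto
qed

text \<open>A gap at \<open>b - int t\<close>, for \<open>b\<close> the beta number of row
  \<open>r\<close>, would produce a hook of length \<open>t\<close> with its corner in row
  \<open>r\<close>.\<close>

lemma core_beta_closed:
  assumes "is_core t lam" "1 \<le> t" "b \<in> beta_set lam"
  shows "b - int t \<in> beta_set lam"
proof (rule ccontr)
  assume notin: "b - int t \<notin> beta_set lam"
  have part: "is_partition lam" using assms(1) by (simp add: is_core_def)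
  obtain r where r: "1 \<le> r" "b = beta lam r" using assms(3) by (auto simp: beta_set_eq_image)
  let ?Q = "\<lambda>k. 1 \<le> k \<and> beta lam k > b - int t"
  obtain N where N: "\<And>i. i > N \<Longrightarrow> lam i = 0" using partition_vanishes[OF part] by blast
  have bound: "k \<le> max N (nat (int t - b))" if "?Q k" for k
    using that N[of k] by (cases "k > N") auto
  \<comment> \<open>The last row whose beta number exceeds the gap; it becomes the foot of the
    hook.\<close>
  define q where "q = Greatest ?Q"
  have Qr: "?Q r" using r assms(2) by auto
  have q: "?Q q" unfolding q_def using Qr bound by (rule GreatestI_nat)
  have "r \<le> q" unfolding q_def using Qr bound by (rule Greatest_le_nat)
  have "\<not> ?Q (q + 1)"
    using Greatest_le_nat[of ?Q "q + 1", OF _ bound] unfolding q_def[symmetric] by force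
  moreover have "beta lam (q + 1) \<noteq> b - int t"
  proof -
    have "beta lam (q + 1) \<in> beta_set lam" unfolding beta_set_eq_image by (rule imageI) simp
    then show ?thesis using notin by metis
  qed
  ultimately have q1: "beta lam (q + 1) < b - int t" by auto
  \<comment> \<open>This solves \<open>hook_length lam r c = int t\<close> for a column ending in
    row \<open>q\<close>. The gap lies strictly between the beta numbers of rows
    \<open>q + 1\<close> and \<open>q\<close>, which says
    \<open>lam (q + 1) < c \<le> lam q\<close>.\<close>
  define c where "c = nat (b - int t + 1 + int q)"
  have c: "int c = b - int t + 1 + int q" using q1 by (simp add: c_def)
  have "1 \<le> c" "lam (q + 1) < c" "c \<le> lam q" using q1 c q by auto
  then have "conjugate lam c = q" using conjugate_eqI[OF part] q by blast
  moreover have "c \<le> lam r"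
    using partition_antimono[OF part r(1) \<open>r \<le> q\<close>] \<open>c \<le> lam q\<close> by simp
  ultimately have "(r, c) \<in> diagram lam" "hook_length lam r c = int t"
    using r \<open>1 \<le> c\<close> c by (auto simp: diagram_def hook_length_def)
  then show False using assms(1) by (auto simp: is_core_def)
qed

text \<open>From row \<open>r\<close> on, a cell in column \<open>j\<close> survives iff
  \<open>j < c\<close> or its diagonal successor is in the diagram, that is
  \<open>j < lam (i + 1)\<close>. The outer \<open>min\<close> keeps rows shorter than
  \<open>c\<close> unchanged.\<close>

definition remove_hook :: "(nat \<Rightarrow> nat) \<Rightarrow> nat \<Rightarrow> nat \<Rightarrow> nat \<Rightarrow> nat" where
  "remove_hook lam r c i = (if r \<le> i then min (lam i) (max c (lam (i + 1)) - 1) else lam i)"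

lemma is_partition_remove_hook:
  assumes "is_partition lam"
  shows "is_partition (remove_hook lam r c)"
  unfolding is_partition_iff_finite_support
proof (intro conjI allI impI)
  show "remove_hook lam r c 0 = 0" using assms by (simp add: remove_hook_def is_partition_def)
  fix i :: nat assume "1 \<le> i"
  then have "lam (i + 1) \<le> lam i" "lam (i + 2) \<le> lam (i + 1)"
    using partition_antimono[OF assms] by auto
  then show "remove_hook lam r c (i + 1) \<le> remove_hook lam r c i"
    by (auto simp: remove_hook_def min_def max_def)
next
  have "finite {i. lam i \<noteq> 0}" using assms by (simp add: is_partition_iff_finite_support)
  then show "finite {i. remove_hook lam r c i \<noteq> 0}"
    by (rule rev_finite_subset) (auto simp: remove_hook_def)
qed

lemma diagram_remove_hook:
  assumes "1 \<le> c"
  shows "diagram (remove_hook lam r c) = diagram lam - rim_hook lam r c"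
proof -
  have "j \<le> remove_hook lam r c i \<longleftrightarrow> j \<le> lam i \<and> (r \<le> i \<longrightarrow> j < c \<or> j < lam (i + 1))" for i j
    using assms by (auto simp: remove_hook_def)
  then show ?thesis by (auto simp: diagram_def rim_hook_def)
qed

lemma diagram_inject:
  assumes "is_partition lam" "is_partition mu" "diagram lam = diagram mu"
  shows "lam = mu"
proof
  fix i
  show "lam i = mu i"
  proof (cases "i = 0")
    case False
    then have "{1..lam i} = {c. (i, c) \<in> diagram lam}" "{1..mu i} = {c. (i, c) \<in> diagram mu}"
      by (auto simp: diagram_def)
    then have "card {1..lam i} = card {1..mu i}" using assms(3) by simp
    then show ?thesis by simp
  qed (use assms in \<open>simp add: is_partition_def\<close>)
qed

text \<open>With \<open>q\<close> the foot of column \<open>c\<close>, rows \<open>r\<close> to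
  \<open>q - 1\<close> take over the beta number of the next row, and row \<open>q\<close> gets
  \<open>beta lam r - int t\<close>. All other rows stay.\<close>

lemma beta_set_remove_hook:
  assumes "is_partition lam" "(r, c) \<in> diagram lam" "hook_length lam r c = int t"
  shows "beta_set (remove_hook lam r c) = insert (beta lam r - int t) (beta_set lam - {beta lam r})"
    and "beta lam r - int t \<notin> beta_set lam"
proof -
  define q where "q = conjugate lam c"
  have rc: "1 \<le> r" "1 \<le> c" "c \<le> lam r" using assms(2) by (auto simp: diagram_def)
  have col: "c \<le> lam k \<longleftrightarrow> k \<le> q" if "1 \<le> k" for k
    using column_eq[OF assms(1) rc(2)] that unfolding q_def by (auto simp: set_eq_iff)
  have "r \<le> q" using col rc by simp
  have t: "beta lam r - int t = int c - 1 - int q"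
    using assms(3) by (simp add: hook_length_def q_def)
  let ?mu = "remove_hook lam r c"
  have lo: "?mu i = lam i" if "i < r" for i using that by (simp add: remove_hook_def)
  \<comment> \<open>Row \<open>i + 1\<close> still reaches column \<open>c\<close>, so row
    \<open>i\<close> shrinks to \<open>lam (i + 1) - 1\<close>.\<close>
  have mid: "beta ?mu i = beta lam (i + 1)" if "r \<le> i" "i < q" for i
    using that rc col[of "i + 1"] partition_antimono[OF assms(1), of i "i + 1"]
    by (auto simp: remove_hook_def)
  \<comment> \<open>Row \<open>q + 1\<close> does not reach column \<open>c\<close>, so row
    \<open>q\<close> shrinks to \<open>c - 1\<close>.\<close>
  have at_q: "beta ?mu q = beta lam r - int t"
    using rc col[of q] col[of "q + 1"] \<open>r \<le> q\<close> t by (auto simp: remove_hook_def)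
  have hi: "?mu i = lam i" if "q < i" for i
    using that rc col[of i] by (auto simp: remove_hook_def)
  have split: "{1..} = {1..<r} \<union> {r..<q} \<union> {q} \<union> {q<..}" using \<open>r \<le> q\<close> rc by auto
  have split': "{1..} - {r} = {1..<r} \<union> Suc ` {r..<q} \<union> {q<..}" using \<open>r \<le> q\<close> rc
    by (auto simp: image_Suc_atLeastLessThan)
  have "beta ?mu ` {r..<q} = beta lam ` Suc ` {r..<q}"
    unfolding image_image using mid by (intro image_cong) auto
  moreover have "beta ?mu ` {1..<r} = beta lam ` {1..<r}" "beta ?mu ` {q<..} = beta lam ` {q<..}"
    using lo hi by auto
  ultimately have "beta_set ?mu = insert (beta lam r - int t) (beta lam ` ({1..} - {r}))"
    unfolding beta_set_eq_image split' by (subst split) (auto simp: image_Un at_q)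
  also have "beta lam ` ({1..} - {r}) = beta_set lam - {beta lam r}"
    unfolding beta_set_eq_image using inj_on_beta[OF assms(1)] rc
    by (subst inj_on_image_set_diff[of _ "{1..}"]) auto
  finally show "beta_set ?mu = insert (beta lam r - int t) (beta_set lam - {beta lam r})" .
  \<comment> \<open>Rows up to \<open>q\<close> have beta number at least \<open>c - q\<close> and
    later rows at most \<open>c - q - 2\<close>, so the value \<open>c - q - 1\<close> is
    skipped.\<close>
  show "beta lam r - int t \<notin> beta_set lam"
  proof
    assume "beta lam r - int t \<in> beta_set lam"
    then obtain k where k: "1 \<le> k" "beta lam k = int c - 1 - int q"
      unfolding t by (auto simp: beta_set_eq_image)
    then show False using col[OF k(1)] by (cases "k \<le> q") auto
  qed
qed

section \<open>Cores\<close>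

text \<open>Any integer \<open>a\<close> is allowed, not only a reduced residue, so that classes can
  be shifted to \<open>a - int s\<close>.\<close>

abbreviation residue_class :: "nat \<Rightarrow> int \<Rightarrow> int set" where
  "residue_class t a \<equiv> {x. x mod int t = a mod int t}"

text \<open>The element \<open>b\<close> that leaves and the element \<open>b - int t\<close> that
  enters lie in the same class, so their contributions cancel.\<close>

lemma balance_removes_rim_hook:
  assumes "removes_rim_hook t lam mu"
  shows "balance (residue_class t a) (beta_set lam) (beta_set mu) = 0"
proof -
  obtain r c where rc: "(r, c) \<in> diagram lam" "hook_length lam r c = int t"
      "diagram mu = diagram lam - rim_hook lam r c"
    and part: "is_partition lam" "is_partition mu"
    using assms by (auto simp: removes_rim_hook_def)
  have "1 \<le> r" "1 \<le> c" using rc(1) by (auto simp: diagram_def)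
  then have "mu = remove_hook lam r c"
    using diagram_inject[OF part(2) is_partition_remove_hook[OF part(1)]] rc(3)
      diagram_remove_hook by metis
  then have mu: "beta_set mu = insert (beta lam r - int t) (beta_set lam - {beta lam r})"
    using beta_set_remove_hook(1)[OF part(1) rc(1,2)] by simp
  have notin: "beta lam r - int t \<notin> beta_set lam"
    by (rule beta_set_remove_hook(2)[OF part(1) rc(1,2)])
  define b where "b = beta lam r"
  have b: "b \<in> beta_set lam" using \<open>1 \<le> r\<close> by (auto simp: beta_set_eq_image b_def)
  \<comment> \<open>One of the two lies in the beta-set and the other does not; in particular
    \<open>t = 0\<close> cannot occur here.\<close>
  have "b - int t \<noteq> b" using notin b unfolding b_def by metis
  moreover have "(b - int t) mod int t = b mod int t"
    by simp
  moreover have "sym_diff (beta_set lam) (beta_set mu) = {b, b - int t}"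
    using b notin unfolding mu b_def[symmetric] by auto
  moreover have "residue_class t a \<inter> {b, b - int t} =
      (if b mod int t = a mod int t then {b, b - int t} else {})"
    by auto
  ultimately show ?thesis
    using b notin mu unfolding balance_def b_def[symmetric] by auto
qed

lemma removes_rim_hooks_partition_balance:
  assumes "(removes_rim_hook t)\<^sup>*\<^sup>* lam mu" "is_partition lam"
  shows "is_partition mu \<and> balance (residue_class t a) (beta_set lam) (beta_set mu) = 0"
  using assms(1)
proof (induction rule: rtranclp_induct)
  case base
  then show ?case using assms(2) by simp
next
  case (step mu nu)
  then have part: "is_partition mu" "is_partition nu" by (auto simp: removes_rim_hook_def)
  then show ?case
    using step balance_removes_rim_hook[OF step(2)]
      balance_trans[OF finite_sym_diff_beta_sets[OF assms(2) part(1)] finite_sym_diff_beta_sets[OF part]]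
    by simp
qed

section \<open>Existence and uniqueness of the core\<close>

lemma finite_diagram:
  assumes "is_partition lam"
  shows "finite (diagram lam)"
proof (rule finite_subset)
  show "diagram lam \<subseteq> (SIGMA i:{i. lam i \<noteq> 0}. {..lam i})" by (auto simp: diagram_def)
  show "finite (SIGMA i:{i. lam i \<noteq> 0}. {..lam i})"
    using assms by (auto simp: is_partition_iff_finite_support)
qed

lemma core_exists:
  assumes "is_partition lam"
  shows "\<exists>mu. (removes_rim_hook t)\<^sup>*\<^sup>* lam mu \<and> is_core t mu"
  using assms
proof (induction "card (diagram lam)" arbitrary: lam rule: less_induct)
  case less
  show ?case
  proof (cases "is_core t lam")
    case True
    then show ?thesis by blast
  next
    case False
    then obtain r c where rc: "(r, c) \<in> diagram lam" "hook_length lam r c = int t"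
      using less.prems by (auto simp: is_core_def)
    let ?mu = "remove_hook lam r c"
    have part: "is_partition ?mu" by (rule is_partition_remove_hook[OF less.prems])
    have bounds: "1 \<le> r" "1 \<le> c" "c \<le> lam r" using rc(1) by (auto simp: diagram_def)
    have diag: "diagram ?mu = diagram lam - rim_hook lam r c"
      using bounds(2) by (rule diagram_remove_hook)
    have rem: "removes_rim_hook t lam ?mu"
      unfolding removes_rim_hook_def using part less.prems rc diag by auto
    \<comment> \<open>The last cell of row \<open>r\<close> always belongs to the rim hook, so the
      number of cells drops strictly and the induction applies.\<close>
    have "(r, lam r) \<in> rim_hook lam r c" "(r, lam r) \<in> diagram lam"
      using bounds partition_antimono[OF less.prems bounds(1), of "r + 1"]
      by (auto simp: rim_hook_def diagram_def)
    then have "diagram ?mu \<subset> diagram lam" using diag by blast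
    then have "card (diagram ?mu) < card (diagram lam)"
      by (rule psubset_card_mono[OF finite_diagram[OF less.prems]])
    then obtain nu where "(removes_rim_hook t)\<^sup>*\<^sup>* ?mu nu" "is_core t nu"
      using less.hyps part by blast
    then show ?thesis using rem by (meson converse_rtranclp_into_rtranclp)
  qed
qed

lemma beta_closed_mod:
  assumes "is_core t lam" "1 \<le> t" "y \<in> beta_set lam" "x \<le> y" "x mod int t = y mod int t"
  shows "x \<in> beta_set lam"
proof -
  have iter: "y - int k * int t \<in> beta_set lam" for k
  proof (induction k)
    case (Suc k)
    then show ?case using core_beta_closed[OF assms(1,2) Suc] by (simp add: algebra_simps)
  qed (use assms in simp)
  have "int t dvd y - x" using assms(5) by (metis mod_eq_dvd_iff)
  then obtain k where k: "y - x = int t * k" ..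
  then have "0 \<le> k" using assms(2,4) by (metis diff_ge_0_iff_ge mult_less_0_iff not_le of_nat_0_less_iff
      less_le_trans zero_less_one)
  then show ?thesis using iter[of "nat k"] k by (simp add: algebra_simps)
qed

text \<open>In each residue class both beta-sets are closed downwards, hence nested, and nested sets
  of balance zero are equal.\<close>

lemma core_unique:
  assumes "is_core t lam" "is_core t mu" "1 \<le> t"
    and balance: "\<And>a. balance (residue_class t a) (beta_set lam) (beta_set mu) = 0"
  shows "lam = mu"
proof -
  have part: "is_partition lam" "is_partition mu" using assms by (auto simp: is_core_def)
  have "residue_class t a \<inter> beta_set lam = residue_class t a \<inter> beta_set mu" for a
  proof (rule balance_eq_0_chain[OF finite_sym_diff_beta_sets[OF part] balance])
    show "residue_class t a \<inter> beta_set lam \<subseteq> beta_set mu \<or>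
        residue_class t a \<inter> beta_set mu \<subseteq> beta_set lam"
    proof (rule ccontr)
      assume "\<not> ?thesis"
      then obtain x y where "x \<in> residue_class t a" "y \<in> residue_class t a"
        and "x \<in> beta_set lam" "x \<notin> beta_set mu" "y \<in> beta_set mu" "y \<notin> beta_set lam"
        by blast
      then show False
        using beta_closed_mod[OF assms(1,3), of x y] beta_closed_mod[OF assms(2,3), of y x]
        by (cases "x \<le> y") auto
    qed
  qed
  then have "beta_set lam = beta_set mu" by blast
  then show ?thesis by (rule beta_set_inject[OF part])
qed

text \<open>Two cores reached from \<open>lam\<close> both have balance zero against
  \<open>lam\<close>, hence against each other. So they coincide, and the \<open>THE\<close> in
  \<open>core_of\<close> is well defined.\<close>

lemma
  assumes "is_partition lam" "1 \<le> t"
  shows is_core_core_of: "is_core t (core_of t lam)"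
    and balance_core_of: "balance (residue_class t a) (beta_set lam) (beta_set (core_of t lam)) = 0"
proof -
  let ?P = "\<lambda>mu. (removes_rim_hook t)\<^sup>*\<^sup>* lam mu \<and> is_core t mu"
  have "mu = nu" if "?P mu" "?P nu" for mu nu
  proof (rule core_unique[of t])
    fix a
    have "is_partition mu" "is_partition nu" using that by (auto simp: is_core_def)
    then show "balance (residue_class t a) (beta_set mu) (beta_set nu) = 0"
      using that removes_rim_hooks_partition_balance[OF _ assms(1), of t _ a]
        balance_trans[OF finite_sym_diff_beta_sets finite_sym_diff_beta_sets, of mu lam nu "residue_class t a"]
        balance_swap[of "residue_class t a" "beta_set mu" "beta_set lam"] assms(1)
      by simp
  qed (use that assms in auto)
  then have "\<exists>!mu. ?P mu" using core_exists[OF assms(1)] by blast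
  then have "?P (core_of t lam)" unfolding core_of_def by (rule theI')
  then show "is_core t (core_of t lam)"
    "balance (residue_class t a) (beta_set lam) (beta_set (core_of t lam)) = 0"
    using removes_rim_hooks_partition_balance[OF _ assms(1)] by blast+
qed

text \<open>Each partition has balance zero against its own core, so the balance of
  \<open>lam\<close> and \<open>mu\<close> equals that of their cores.\<close>

lemma core_of_eq_iff:
  assumes "is_partition lam" "is_partition mu" "1 \<le> t"
  shows "core_of t lam = core_of t mu \<longleftrightarrow>
    (\<forall>a. balance (residue_class t a) (beta_set lam) (beta_set mu) = 0)"
proof -
  let ?B = "\<lambda>a nu ka. balance (residue_class t a) (beta_set nu) (beta_set ka)"
  have part: "is_partition (core_of t lam)" "is_partition (core_of t mu)"
    using is_core_core_of[OF assms(1,3)] is_core_core_of[OF assms(2,3)] by (simp_all add: is_core_def)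
  have eq: "?B a lam mu = ?B a (core_of t lam) (core_of t mu)" for a
  proof -
    have "?B a lam mu = ?B a lam (core_of t lam) + ?B a (core_of t lam) mu"
      using assms part by (intro balance_trans finite_sym_diff_beta_sets)
    also have "?B a (core_of t lam) mu =
        ?B a (core_of t lam) (core_of t mu) + ?B a (core_of t mu) mu"
      using assms part by (intro balance_trans finite_sym_diff_beta_sets)
    also have "?B a (core_of t mu) mu = 0"
      by (subst balance_swap) (simp add: balance_core_of[OF assms(2,3)])
    finally show ?thesis using balance_core_of[OF assms(1,3)] by simp
  qed
  show ?thesis
  proof
    assume "core_of t lam = core_of t mu"
    then show "\<forall>a. ?B a lam mu = 0" unfolding eq by simp
  next
    assume "\<forall>a. ?B a lam mu = 0"
    then show "core_of t lam = core_of t mu" unfolding eq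
      by (intro core_unique[OF is_core_core_of[OF assms(1,3)] is_core_core_of[OF assms(2,3)] assms(3)])
        simp
  qed
qed

section \<open>Residues of the s-set\<close>

text \<open>The beta-set of an s-core is contained in its shift by \<open>s\<close>, so this balance
  has no negative terms and counts the elements of the s-set in the class.\<close>

lemma count_s_set_residues:
  assumes "is_core s lam" "1 \<le> s"
  shows "int (count (s_set_residues s t lam) (a mod int t)) =
    balance (residue_class t a) ((\<lambda>b. b + int s) ` beta_set lam) (beta_set lam)"
proof -
  have part: "is_partition lam" using assms(1) by (simp add: is_core_def)
  have sub: "beta_set lam \<subseteq> (\<lambda>b. b + int s) ` beta_set lam"
  proof
    fix b assume "b \<in> beta_set lam"
    then have "b - int s \<in> beta_set lam" by (rule core_beta_closed[OF assms])
    then show "b \<in> (\<lambda>b. b + int s) ` beta_set lam" by (rule rev_image_eqI) simp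
  qed
  have fin: "finite (s_set s lam)"
    using finite_sym_diff_beta_set_shift[OF part] by (simp add: s_set_def)
  have "count (s_set_residues s t lam) (a mod int t) = card (residue_class t a \<inter> s_set s lam)"
    using fin by (simp add: s_set_residues_def count_image_mset vimage_def Int_def conj_commute)
  then show ?thesis by (simp add: balance_superset[OF sub] s_set_def)
qed

lemma s_set_residues_eq_iff:
  assumes "is_core s lam" "is_core s mu" "1 \<le> s" "1 \<le> t"
  defines "d \<equiv> \<lambda>a. balance (residue_class t a) (beta_set lam) (beta_set mu)"
  shows "s_set_residues s t lam = s_set_residues s t mu \<longleftrightarrow> (\<forall>a. d (a - int s) = d a)"
proof -
  let ?sh = "\<lambda>b. b + int s"
  have part: "is_partition lam" "is_partition mu" using assms by (auto simp: is_core_def)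
  have fin: "finite (sym_diff (beta_set lam) (beta_set mu))"
    by (rule finite_sym_diff_beta_sets[OF part])
  have fin_sh: "finite (sym_diff (?sh ` beta_set nu) (beta_set nu))" if "is_partition nu" for nu
    by (rule finite_sym_diff_beta_set_shift[OF that])
  have diff: "int (count (s_set_residues s t lam) (a mod int t)) -
      int (count (s_set_residues s t mu) (a mod int t)) = d (a - int s) - d a" for a
  proof -
    let ?B = "balance (residue_class t a)"
    \<comment> \<open>Shifting both sets by \<open>s\<close> amounts to moving the class back by
      \<open>s\<close>.\<close>
    have "?sh -` residue_class t a = residue_class t (a - int s)"
      by (auto simp: mod_eq_dvd_iff algebra_simps)
    then have sh: "?B (?sh ` beta_set lam) (?sh ` beta_set mu) = d (a - int s)"
      unfolding d_def by (subst balance_image) (auto simp: inj_def)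
    have "sym_diff (?sh ` beta_set lam) (?sh ` beta_set mu) = ?sh ` sym_diff (beta_set lam) (beta_set mu)"
      by auto
    then have fin_sh2: "finite (sym_diff (?sh ` beta_set lam) (?sh ` beta_set mu))"
      using fin by simp
    \<comment> \<open>The balance of the shifted \<open>lam\<close> against \<open>mu\<close> is
      split in two ways, through \<open>lam\<close> and through the shifted \<open>mu\<close>;
      comparing them gives \<open>diff\<close>.\<close>
    have "?B (?sh ` beta_set lam) (beta_set mu) = ?B (?sh ` beta_set lam) (beta_set lam) + d a"
      unfolding d_def using fin fin_sh[OF part(1)] by (rule balance_trans[rotated])
    moreover have "?B (?sh ` beta_set lam) (beta_set mu) =
        d (a - int s) + ?B (?sh ` beta_set mu) (beta_set mu)"
      using balance_trans[OF fin_sh2 fin_sh[OF part(2)]] sh by simp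
    ultimately show ?thesis
      using count_s_set_residues[OF assms(1,3)] count_s_set_residues[OF assms(2,3)] by simp
  qed
  show ?thesis
  proof
    assume "s_set_residues s t lam = s_set_residues s t mu"
    then show "\<forall>a. d (a - int s) = d a" using diff by simp
  next
    assume d: "\<forall>a. d (a - int s) = d a"
    show "s_set_residues s t lam = s_set_residues s t mu"
    proof (rule multiset_eqI)
      fix a
      show "count (s_set_residues s t lam) a = count (s_set_residues s t mu) a"
      proof (cases "a mod int t = a")
        case True
        then show ?thesis using diff[of a] d by simp
      next
        case False
        then have "a \<notin># s_set_residues s t nu" for nu by (auto simp: s_set_residues_def)
        then show ?thesis by (simp add: not_in_iff)
      qed
    qed
  qed
qed

text \<open>A function on the residues modulo \<open>t\<close> that is invariant under the step
  \<open>s\<close> is constant, since \<open>s\<close> generates all residues. Its values sum to the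
  total balance 0, so the constant is 0.\<close>

lemma balance_shift_invariant_iff:
  assumes "is_partition lam" "is_partition mu" "1 \<le> t" "coprime s t"
  defines "d \<equiv> \<lambda>a. balance (residue_class t a) (beta_set lam) (beta_set mu)"
  shows "(\<forall>a. d (a - int s) = d a) \<longleftrightarrow> (\<forall>a. d a = 0)"
proof
  assume inv: "\<forall>a. d (a - int s) = d a"
  have iter: "d (a - int k * int s) = d a" for a k
  proof (induction k)
    case (Suc k)
    then show ?case using inv[rule_format, of "a - int k * int s"] by (simp add: algebra_simps)
  qed simp
  have cong: "d a = d b" if "a mod int t = b mod int t" for a b
    using that by (simp add: d_def)
  have const: "d a = d 0" for a
  proof -
    \<comment> \<open>With \<open>x\<close> an inverse of \<open>s\<close> modulo \<open>t\<close>,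
      \<open>k\<close> steps of size \<open>s\<close> lead from \<open>a\<close> to a multiple of
      \<open>t\<close>. Reducing \<open>a\<close> first keeps \<open>k\<close> a natural
      number.\<close>
    obtain x where x: "[s * x = 1] (mod t)" using cong_solve_coprime_nat[OF assms(4)] by auto
    define k where "k = x * nat (a mod int t)"
    have "[int s * int x = 1] (mod int t)" using x by (metis cong_int_iff of_nat_1 of_nat_mult)
    then have "[int s * int x * (a mod int t) = 1 * a] (mod int t)"
      by (intro cong_mult) (auto simp: cong_def)
    moreover have "int k = int x * (a mod int t)" using assms(3) by (simp add: k_def)
    ultimately have "[int k * int s = a] (mod int t)" by (simp add: mult_ac)
    then have "[a - int k * int s = a - a] (mod int t)" by (intro cong_diff cong_refl)
    then show ?thesis using cong[of "a - int k * int s" 0] iter[of a k] by (simp add: cong_def)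
  qed
  have "balance UNIV (beta_set lam) (beta_set mu) =
      (\<Sum>i\<in>{0..<int t}. balance {x. x mod int t = i} (beta_set lam) (beta_set mu))"
    using finite_sym_diff_beta_sets[OF assms(1,2)] assms(3) by (intro balance_UNIV_partition) auto
  also have "\<dots> = (\<Sum>i\<in>{0..<int t}. d i)"
    by (intro sum.cong) (auto simp: d_def)
  also have "\<dots> = (\<Sum>i\<in>{0..<int t}. d 0)"
    by (intro sum.cong refl const)
  also have "\<dots> = int t * d 0" by simp
  finally have "d 0 = 0" using balance_UNIV_beta_sets[OF assms(1,2)] assms(3) by simp
  then show "\<forall>a. d a = 0" using const by simp
qed simp

theorem proposition3p6:
  fixes s t :: nat
  assumes "s \<ge> 1" and "t \<ge> 1" and "coprime s t"
  shows "(\<exists>F :: int multiset \<Rightarrow> (nat \<Rightarrow> nat).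
            \<forall>lam. is_core s lam \<longrightarrow> core_of t lam = F (s_set_residues s t lam)) \<and>
         (\<forall>lam mu. is_core s lam \<longrightarrow> is_core s mu \<longrightarrow>
            (core_of t lam = core_of t mu \<longleftrightarrow>
             s_set_residues s t lam = s_set_residues s t mu))"
proof -
  have iff: "core_of t lam = core_of t mu \<longleftrightarrow> s_set_residues s t lam = s_set_residues s t mu"
    if "is_core s lam" "is_core s mu" for lam mu
  proof -
    have "is_partition lam" "is_partition mu" using that by (auto simp: is_core_def)
    then show ?thesis
      using core_of_eq_iff s_set_residues_eq_iff[OF that] balance_shift_invariant_iff assms by simp
  qed
  \<comment> \<open>Any s-core with the given residues may be chosen, since by \<open>iff\<close>
    all of them have the same t-core. For multisets that do not arise the value is
    arbitrary.\<close>
  define F where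
    "F m = core_of t (SOME lam. is_core s lam \<and> s_set_residues s t lam = m)" for m
  have "core_of t lam = F (s_set_residues s t lam)" if "is_core s lam" for lam
  proof -
    let ?P = "\<lambda>mu. is_core s mu \<and> s_set_residues s t mu = s_set_residues s t lam"
    have "?P (Eps ?P)" by (rule someI[of ?P lam]) (use that in simp)
    then show ?thesis using iff[OF that] unfolding F_def by metis
  qed
  then show ?thesis using iff by blast
qed

end
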